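(* Let $F$ be a field and let $\mathrm{FinVect}_F$ be the category of finite-dimensional $F$-vector spaces and $F$-linear maps. Then every Cartesian tangent structure $(T,p,0,+,\ell,c)$ on $\mathrm{FinVect}_F$ satisfies either $$T(V)\cong V\quad\text{for all objects } V \text{ of } \mathrm{FinVect}_F,$$ or $$T(V)\cong V\times V\quad\text{for all objects } V \text{ of } \mathrm{FinVect}_F.$$
   Context: Additive bundles. An additive bundle $(X,A,p,+,0)$ over an object $A$ of a category is a morphism $p:X\to A$ all of whose finite pullback powers $X_n$ (the $n$-fold fibre product of $X$ with itself over $A$) exist, together with morphisms $+:X_2\to X$ and $0:A\to X$ such that $p\circ + = p\circ\pi_0=p\circ\pi_1$, $p\circ 0=1_A$, and $+$ is associative, commutative and unital with unit $0$ (i.e. $+\circ\langle 0\circ p,1_X\rangle=1_X$). An additive bundle morphism $(X,A,p,+,0)\to(Y,B,p',+',0')$ is a pair $f:X\to Y$, $g:A\to B$ with $p'\circ f=g\circ p$, $f\circ + = +'\circ\langle f\pi_0,f\pi_1\rangle$ and $f\circ 0=0'\circ g$. Tangent category. A tangent category $(\mathbb X,T,p,0,+,\ell,c)$ (the data $(T,p,0,+,\ell,c)$ being a tangent structure on $\mathbb X$) consists of a category $\mathbb X$ and: a functor $T:\mathbb X\to\mathbb X$ and a natural transformation $p:T\to 1$ such that all pullback powers $T_nM$ of $p_M:TM\to M$ exist and are preserved by $T$; natural transformations $+:T_2\to T$ and $0:1\to T$ making each $(TM,M,p_M,+_M,0_M)$ an additive bundle; a natural transformation $\ell:T\to T^2$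 such that $(\ell_M,0_M)$ is an additive bundle morphism from $(TM,M,p_M,+_M,0_M)$ to $(T^2M,TM,T(p_M),T(+_M),T(0_M))$; a natural transformation $c:T^2\to T^2$ with $c\circ c=1$ and $c\circ\ell=\ell$ such that $(c_M,1)$ is an additive bundle morphism from $(T^2M,TM,T(p_M),T(+_M),T(0_M))$ to $(T^2M,TM,p_{TM},+_{TM},0_{TM})$. Moreover $T(\ell_M)\circ\ell_M=\ell_{TM}\circ\ell_M$, $c_{TM}\circ T(c_M)\circ c_{TM}=T(c_M)\circ c_{TM}\circ T(c_M)$, $c_{TM}\circ T(c_M)\circ\ell_{TM}=T(\ell_M)\circ c_M$, and (universality of the vertical lift) the commutative square with top $\nu:T_2M\to T^2M$, $\nu=T(+_M)\circ\langle\ell_M\circ\pi_0,0_{TM}\circ\pi_1\rangle$, left side $p_M\circ\pi_0:T_2M\to M$, right side $T(p_M):T^2M\to TM$ and bottom $0_M:M\to TM$ is a pullback preserved by all powers of $T$. Here $T^2=T\circ T$, while $T_2$ denotes the pullback of $p$ along itself. A tangent structure is Cartesian if $\mathbb X$ has finite products and they are compatible with the tangent structure, i.e. $T$ preserves finite products (via the canonical maps induced by applying $T$ to the projections). *)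

theory Defs
  imports "Jordan_Normal_Form.Missing_VectorSpace"
begin

section \<open>Categories, functors and natural transformations\<close>

record ('o, 'm) precategory =
  Obj :: "'o set"
  Arr :: "'m set"
  Dom :: "'m \<Rightarrow> 'o"
  Cod :: "'m \<Rightarrow> 'o"
  Idn :: "'o \<Rightarrow> 'm"
  Cmp :: "'m \<Rightarrow> 'm \<Rightarrow> 'm"  (infixr \<open>\<cdot>\<index>\<close> 70)

definition homset :: "('o, 'm) precategory \<Rightarrow> 'o \<Rightarrow> 'o \<Rightarrow> 'm set" where
  "homset C A B = {f \<in> Arr C. Dom C f = A \<and> Cod C f = B}"

locale category =
  fixes C :: "('o, 'm) precategory" (structure)
  assumes dom_obj: "f \<in> Arr C \<Longrightarrow> Dom C f \<in> Obj C"
    and cod_obj: "f \<in> Arr C \<Longrightarrow> Cod C f \<in> Obj C"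
    and idn_hom: "A \<in> Obj C \<Longrightarrow> Idn C A \<in> homset C A A"
    and cmp_hom: "f \<in> homset C A B \<Longrightarrow> g \<in> homset C B D \<Longrightarrow> g \<cdot> f \<in> homset C A D"
    and idn_left: "f \<in> homset C A B \<Longrightarrow> Idn C B \<cdot> f = f"
    and idn_right: "f \<in> homset C A B \<Longrightarrow> f \<cdot> Idn C A = f"
    and cmp_assoc: "f \<in> homset C A B \<Longrightarrow> g \<in> homset C B D \<Longrightarrow> h \<in> homset C D E \<Longrightarrow>
      (h \<cdot> g) \<cdot> f = h \<cdot> (g \<cdot> f)"

definition isomorphic_obj :: "('o, 'm) precategory \<Rightarrow> 'o \<Rightarrow> 'o \<Rightarrow> bool" where
  "isomorphic_obj C A B \<longleftrightarrow>
    (\<exists>f \<in> homset C A B. \<exists>g \<in> homset C B A.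
      g \<cdot>\<^bsub>C\<^esub> f = Idn C A \<and> f \<cdot>\<^bsub>C\<^esub> g = Idn C B)"

record ('o, 'm) endomap =
  fob :: "'o \<Rightarrow> 'o"
  far :: "'m \<Rightarrow> 'm"

locale endofunctor = category C
  for C :: "('o, 'm) precategory" (structure) +
  fixes T :: "('o, 'm) endomap"
  assumes fob_obj: "A \<in> Obj C \<Longrightarrow> fob T A \<in> Obj C"
    and far_hom: "f \<in> homset C A B \<Longrightarrow> far T f \<in> homset C (fob T A) (fob T B)"
    and far_idn: "A \<in> Obj C \<Longrightarrow> far T (Idn C A) = Idn C (fob T A)"
    and far_cmp: "f \<in> homset C A B \<Longrightarrow> g \<in> homset C B D \<Longrightarrow> far T (g \<cdot> f) = far T g \<cdot> far T f"

definition fun_id :: "('o, 'm) endomap" where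
  "fun_id = \<lparr>fob = (\<lambda>A. A), far = (\<lambda>f. f)\<rparr>"

definition fun_comp :: "('o, 'm) endomap \<Rightarrow> ('o, 'm) endomap \<Rightarrow> ('o, 'm) endomap" where
  "fun_comp S T = \<lparr>fob = (\<lambda>A. fob S (fob T A)), far = (\<lambda>f. far S (far T f))\<rparr>"

primrec fun_pow :: "('o, 'm) endomap \<Rightarrow> nat \<Rightarrow> ('o, 'm) endomap" where
  "fun_pow T 0 = fun_id"
| "fun_pow T (Suc n) = fun_comp T (fun_pow T n)"

definition nat_trans ::
  "('o, 'm) precategory \<Rightarrow> ('o, 'm) endomap \<Rightarrow> ('o, 'm) endomap \<Rightarrow> ('o \<Rightarrow> 'm) \<Rightarrow> bool" where
  "nat_trans C G H \<alpha> \<longleftrightarrow>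
    endofunctor C G \<and> endofunctor C H \<and>
    (\<forall>A \<in> Obj C. \<alpha> A \<in> homset C (fob G A) (fob H A)) \<and>
    (\<forall>A \<in> Obj C. \<forall>B \<in> Obj C. \<forall>f \<in> homset C A B. far H f \<cdot>\<^bsub>C\<^esub> \<alpha> A = \<alpha> B \<cdot>\<^bsub>C\<^esub> far G f)"


section \<open>Finite products, pullbacks and fibre powers\<close>

text \<open>Finite families are functions on \<^typ>\<open>nat\<close> of which only the values below \<open>n\<close> matter;
  in particular a product of \<open>0\<close> objects is a terminal object.\<close>

definition is_product ::
  "('o, 'm) precategory \<Rightarrow> nat \<Rightarrow> (nat \<Rightarrow> 'o) \<Rightarrow> 'o \<Rightarrow> (nat \<Rightarrow> 'm) \<Rightarrow> bool" where
  "is_product C n A P \<pi> \<longleftrightarrow>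
    P \<in> Obj C \<and> (\<forall>i<n. A i \<in> Obj C \<and> \<pi> i \<in> homset C P (A i)) \<and>
    (\<forall>Z \<in> Obj C. \<forall>x. (\<forall>i<n. x i \<in> homset C Z (A i)) \<longrightarrow>
      (\<exists>!h. h \<in> homset C Z P \<and> (\<forall>i<n. \<pi> i \<cdot>\<^bsub>C\<^esub> h = x i)))"

definition has_finite_products :: "('o, 'm) precategory \<Rightarrow> bool" where
  "has_finite_products C \<longleftrightarrow>
    (\<forall>n A. (\<forall>i<n. A i \<in> Obj C) \<longrightarrow> (\<exists>P \<pi>. is_product C n A P \<pi>))"

definition preserves_finite_products :: "('o, 'm) precategory \<Rightarrow> ('o, 'm) endomap \<Rightarrow> bool" where
  "preserves_finite_products C T \<longleftrightarrow>
    (\<forall>n A P \<pi>. is_product C n A P \<pi> \<longrightarrow>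
      is_product C n (\<lambda>i. fob T (A i)) (fob T P) (\<lambda>i. far T (\<pi> i)))"

definition is_pullback :: "('o, 'm) precategory \<Rightarrow> 'm \<Rightarrow> 'm \<Rightarrow> 'm \<Rightarrow> 'm \<Rightarrow> bool" where
  \<comment> \<open>top, left, right and bottom side of the square, in this order\<close>
  "is_pullback C t l r b \<longleftrightarrow>
    t \<in> Arr C \<and> l \<in> Arr C \<and> r \<in> Arr C \<and> b \<in> Arr C \<and>
    Dom C t = Dom C l \<and> Cod C t = Dom C r \<and> Cod C l = Dom C b \<and> Cod C r = Cod C b \<and>
    r \<cdot>\<^bsub>C\<^esub> t = b \<cdot>\<^bsub>C\<^esub> l \<and>
    (\<forall>Z \<in> Obj C. \<forall>u \<in> homset C Z (Dom C r). \<forall>v \<in> homset C Z (Dom C b).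
      r \<cdot>\<^bsub>C\<^esub> u = b \<cdot>\<^bsub>C\<^esub> v \<longrightarrow>
      (\<exists>!h. h \<in> homset C Z (Dom C t) \<and> t \<cdot>\<^bsub>C\<^esub> h = u \<and> l \<cdot>\<^bsub>C\<^esub> h = v))"

text \<open>\<open>P\<close> is an \<open>n\<close>-fold fibre product of \<open>p : X \<rightarrow> A\<close> with itself, with projections
  \<open>\<pi> 0, \<dots>, \<pi> (n - 1)\<close>. The common composite \<open>q : P \<rightarrow> A\<close> is kept explicit so that the
  definition also covers \<open>n = 0\<close>, where it says that \<open>q\<close> is an isomorphism.\<close>

definition is_fibre_power ::
  "('o, 'm) precategory \<Rightarrow> 'm \<Rightarrow> nat \<Rightarrow> 'o \<Rightarrow> 'm \<Rightarrow> (nat \<Rightarrow> 'm) \<Rightarrow> bool" where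
  "is_fibre_power C p n P q \<pi> \<longleftrightarrow>
    p \<in> Arr C \<and> P \<in> Obj C \<and> q \<in> homset C P (Cod C p) \<and>
    (\<forall>i<n. \<pi> i \<in> homset C P (Dom C p) \<and> p \<cdot>\<^bsub>C\<^esub> \<pi> i = q) \<and>
    (\<forall>Z \<in> Obj C. \<forall>r \<in> homset C Z (Cod C p). \<forall>x.
      (\<forall>i<n. x i \<in> homset C Z (Dom C p) \<and> p \<cdot>\<^bsub>C\<^esub> x i = r) \<longrightarrow>
      (\<exists>!h. h \<in> homset C Z P \<and> q \<cdot>\<^bsub>C\<^esub> h = r \<and> (\<forall>i<n. \<pi> i \<cdot>\<^bsub>C\<^esub> h = x i)))"

text \<open>The morphism \<open>\<langle>x, y\<rangle>\<close> into a twofold fibre product with projections \<open>\<pi> 0\<close>, \<open>\<pi> 1\<close>;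
  meaningful only if \<open>x\<close> and \<open>y\<close> agree over the base.\<close>

definition pairing :: "('o, 'm) precategory \<Rightarrow> (nat \<Rightarrow> 'm) \<Rightarrow> 'm \<Rightarrow> 'm \<Rightarrow> 'm" where
  "pairing C \<pi> x y =
    (THE h. h \<in> homset C (Dom C x) (Dom C (\<pi> 0)) \<and> \<pi> 0 \<cdot>\<^bsub>C\<^esub> h = x \<and> \<pi> 1 \<cdot>\<^bsub>C\<^esub> h = y)"


section \<open>Additive bundles\<close>

text \<open>Fibre products are only determined up to isomorphism, so a bundle carries the chosen
  twofold fibre product \<open>Sq\<close>, with projections \<open>Pr 0\<close> and \<open>Pr 1\<close>, on which the addition
  \<open>Pls\<close> is defined.\<close>

record ('o, 'm) bundle_data =
  Tot :: 'o
  Bas :: 'o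
  Prj :: 'm
  Sq :: 'o
  Pr :: "nat \<Rightarrow> 'm"
  Pls :: 'm
  Zro :: 'm

definition additive_bundle :: "('o, 'm) precategory \<Rightarrow> ('o, 'm) bundle_data \<Rightarrow> bool" where
  "additive_bundle C E \<longleftrightarrow>
    Prj E \<in> homset C (Tot E) (Bas E) \<and>
    (\<forall>n. \<exists>P q \<pi>. is_fibre_power C (Prj E) n P q \<pi>) \<and>
    is_fibre_power C (Prj E) 2 (Sq E) (Prj E \<cdot>\<^bsub>C\<^esub> Pr E 0) (Pr E) \<and>
    Pls E \<in> homset C (Sq E) (Tot E) \<and>
    Zro E \<in> homset C (Bas E) (Tot E) \<and>
    Prj E \<cdot>\<^bsub>C\<^esub> Pls E = Prj E \<cdot>\<^bsub>C\<^esub> Pr E 0 \<and>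
    Prj E \<cdot>\<^bsub>C\<^esub> Pls E = Prj E \<cdot>\<^bsub>C\<^esub> Pr E 1 \<and>
    Prj E \<cdot>\<^bsub>C\<^esub> Zro E = Idn C (Bas E) \<and>
    (\<forall>P q \<pi>. is_fibre_power C (Prj E) 3 P q \<pi> \<longrightarrow>
      Pls E \<cdot>\<^bsub>C\<^esub> pairing C (Pr E) (Pls E \<cdot>\<^bsub>C\<^esub> pairing C (Pr E) (\<pi> 0) (\<pi> 1)) (\<pi> 2) =
      Pls E \<cdot>\<^bsub>C\<^esub> pairing C (Pr E) (\<pi> 0) (Pls E \<cdot>\<^bsub>C\<^esub> pairing C (Pr E) (\<pi> 1) (\<pi> 2))) \<and>
    Pls E \<cdot>\<^bsub>C\<^esub> pairing C (Pr E) (Pr E 1) (Pr E 0) = Pls E \<and>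
    Pls E \<cdot>\<^bsub>C\<^esub> pairing C (Pr E) (Zro E \<cdot>\<^bsub>C\<^esub> Prj E) (Idn C (Tot E)) = Idn C (Tot E)"

definition additive_bundle_morphism ::
  "('o, 'm) precategory \<Rightarrow> ('o, 'm) bundle_data \<Rightarrow> ('o, 'm) bundle_data \<Rightarrow> 'm \<Rightarrow> 'm \<Rightarrow> bool" where
  "additive_bundle_morphism C E E' f g \<longleftrightarrow>
    additive_bundle C E \<and> additive_bundle C E' \<and>
    f \<in> homset C (Tot E) (Tot E') \<and> g \<in> homset C (Bas E) (Bas E') \<and>
    Prj E' \<cdot>\<^bsub>C\<^esub> f = g \<cdot>\<^bsub>C\<^esub> Prj E \<and>
    f \<cdot>\<^bsub>C\<^esub> Pls E = Pls E' \<cdot>\<^bsub>C\<^esub> pairing C (Pr E') (f \<cdot>\<^bsub>C\<^esub> Pr E 0) (f \<cdot>\<^bsub>C\<^esub> Pr E 1) \<and>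
    f \<cdot>\<^bsub>C\<^esub> Zro E = Zro E' \<cdot>\<^bsub>C\<^esub> g"

definition bundle_image :: "('o, 'm) endomap \<Rightarrow> ('o, 'm) bundle_data \<Rightarrow> ('o, 'm) bundle_data" where
  "bundle_image T E =
    \<lparr>Tot = fob T (Tot E), Bas = fob T (Bas E), Prj = far T (Prj E),
     Sq = fob T (Sq E), Pr = (\<lambda>i. far T (Pr E i)), Pls = far T (Pls E), Zro = far T (Zro E)\<rparr>"


section \<open>Tangent categories\<close>

text \<open>The object \<open>tsq S M\<close>, with projections \<open>tpr S M 0\<close> and \<open>tpr S M 1\<close>, is the chosen
  fibre product \<open>T\<^sub>2 M\<close>.\<close>

record ('o, 'm) tangent_data =
  tfun :: "('o, 'm) endomap"
  tproj :: "'o \<Rightarrow> 'm"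
  tsq :: "'o \<Rightarrow> 'o"
  tpr :: "'o \<Rightarrow> nat \<Rightarrow> 'm"
  tzero :: "'o \<Rightarrow> 'm"
  tplus :: "'o \<Rightarrow> 'm"
  tlift :: "'o \<Rightarrow> 'm"
  tflip :: "'o \<Rightarrow> 'm"

abbreviation tob :: "('o, 'm) tangent_data \<Rightarrow> 'o \<Rightarrow> 'o" where
  "tob S \<equiv> fob (tfun S)"

abbreviation tar :: "('o, 'm) tangent_data \<Rightarrow> 'm \<Rightarrow> 'm" where
  "tar S \<equiv> far (tfun S)"

definition tangent_bundle :: "('o, 'm) tangent_data \<Rightarrow> 'o \<Rightarrow> ('o, 'm) bundle_data" where
  "tangent_bundle S M =
    \<lparr>Tot = tob S M, Bas = M, Prj = tproj S M,
     Sq = tsq S M, Pr = tpr S M, Pls = tplus S M, Zro = tzero S M\<rparr>"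

definition tsq_fun :: "('o, 'm) precategory \<Rightarrow> ('o, 'm) tangent_data \<Rightarrow> ('o, 'm) endomap" where
  "tsq_fun C S =
    \<lparr>fob = tsq S,
     far = (\<lambda>f. pairing C (tpr S (Cod C f))
       (tar S f \<cdot>\<^bsub>C\<^esub> tpr S (Dom C f) 0) (tar S f \<cdot>\<^bsub>C\<^esub> tpr S (Dom C f) 1))\<rparr>"

definition vertical_nu :: "('o, 'm) precategory \<Rightarrow> ('o, 'm) tangent_data \<Rightarrow> 'o \<Rightarrow> 'm" where
  "vertical_nu C S M =
    tar S (tplus S M) \<cdot>\<^bsub>C\<^esub>
      pairing C (\<lambda>i. tar S (tpr S M i))
        (tlift S M \<cdot>\<^bsub>C\<^esub> tpr S M 0) (tzero S (tob S M) \<cdot>\<^bsub>C\<^esub> tpr S M 1)"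

locale tangent_category =
  fixes C :: "('o, 'm) precategory" (structure)
    and S :: "('o, 'm) tangent_data"
  assumes T_functor: "endofunctor C (tfun S)"
    and p_nat: "nat_trans C (tfun S) fun_id (tproj S)"
    and fibre_powers_exist:
      "M \<in> Obj C \<Longrightarrow> \<exists>P q \<pi>. is_fibre_power C (tproj S M) n P q \<pi>"
    and fibre_powers_preserved:
      "M \<in> Obj C \<Longrightarrow> is_fibre_power C (tproj S M) n P q \<pi> \<Longrightarrow>
        is_fibre_power C (tar S (tproj S M)) n (tob S P) (tar S q) (\<lambda>i. tar S (\<pi> i))"
    and tangent_bundle_additive: "M \<in> Obj C \<Longrightarrow> additive_bundle C (tangent_bundle S M)"
    and plus_nat: "nat_trans C (tsq_fun C S) (tfun S) (tplus S)"
    and zero_nat: "nat_trans C fun_id (tfun S) (tzero S)"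
    and lift_nat: "nat_trans C (tfun S) (fun_comp (tfun S) (tfun S)) (tlift S)"
    and lift_additive:
      "M \<in> Obj C \<Longrightarrow> additive_bundle_morphism C
        (tangent_bundle S M) (bundle_image (tfun S) (tangent_bundle S M)) (tlift S M) (tzero S M)"
    and flip_nat: "nat_trans C (fun_comp (tfun S) (tfun S)) (fun_comp (tfun S) (tfun S)) (tflip S)"
    and flip_flip: "M \<in> Obj C \<Longrightarrow> tflip S M \<cdot> tflip S M = Idn C (tob S (tob S M))"
    and flip_lift: "M \<in> Obj C \<Longrightarrow> tflip S M \<cdot> tlift S M = tlift S M"
    and flip_additive:
      "M \<in> Obj C \<Longrightarrow> additive_bundle_morphism C
        (bundle_image (tfun S) (tangent_bundle S M)) (tangent_bundle S (tob S M))
        (tflip S M) (Idn C (tob S M))"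
    and lift_lift:
      "M \<in> Obj C \<Longrightarrow> tar S (tlift S M) \<cdot> tlift S M = tlift S (tob S M) \<cdot> tlift S M"
    and flip_braid:
      "M \<in> Obj C \<Longrightarrow>
        tflip S (tob S M) \<cdot> tar S (tflip S M) \<cdot> tflip S (tob S M) =
        tar S (tflip S M) \<cdot> tflip S (tob S M) \<cdot> tar S (tflip S M)"
    and flip_lift_flip:
      "M \<in> Obj C \<Longrightarrow>
        tflip S (tob S M) \<cdot> tar S (tflip S M) \<cdot> tlift S (tob S M) =
        tar S (tlift S M) \<cdot> tflip S M"
    and lift_universal:
      "M \<in> Obj C \<Longrightarrow> is_pullback C
        (far (fun_pow (tfun S) n) (vertical_nu C S M))
        (far (fun_pow (tfun S) n) (tproj S M \<cdot> tpr S M 0))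
        (far (fun_pow (tfun S) n) (tar S (tproj S M)))
        (far (fun_pow (tfun S) n) (tzero S M))"

locale cartesian_tangent_category = tangent_category C S
  for C :: "('o, 'm) precategory" (structure) and S +
  assumes finite_products: "has_finite_products C"
    and products_preserved: "preserves_finite_products C (tfun S)"


section \<open>Finite-dimensional vector spaces\<close>

text \<open>The objects are all finite-dimensional vector spaces over \<open>F\<close> whose underlying set is a
  subset of the type \<open>'v\<close>, which plays the role of a universe. The ring multiplication and
  unit that a \<open>module\<close> record also contains are irrelevant for \<open>vectorspace\<close>. Linear maps are
  extensional, so that equality of arrows is equality on the domain.\<close>

type_synonym ('a, 'v) linear_arrow = "('a, 'v) module \<times> ('v \<Rightarrow> 'v) \<times> ('a, 'v) module"

definition FinVect ::
  "('a, 'k) ring_scheme \<Rightarrow> (('a, 'v) module, ('a, 'v) linear_arrow) precategory" where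
  "FinVect F =
    \<lparr>Obj = {V. vectorspace F V \<and> vectorspace.fin_dim F V},
     Arr = {(V, f, W).
       vectorspace F V \<and> vectorspace.fin_dim F V \<and>
       vectorspace F W \<and> vectorspace.fin_dim F W \<and>
       linear_map F V W f \<and> f \<in> extensional (carrier V)},
     Dom = (\<lambda>(V, f, W). V),
     Cod = (\<lambda>(V, f, W). W),
     Idn = (\<lambda>V. (V, restrict id (carrier V), V)),
     Cmp = (\<lambda>(V', g, W') (V, f, W). (V, compose (carrier V) g f, W'))\<rparr>"

lemma FinVect_category:
  fixes F :: "('a, 'k) ring_scheme"
  shows "category (FinVect F :: (('a, 'v) module, ('a, 'v) linear_arrow) precategory)"
proof -
  have lin: "linear_map F V W f \<longleftrightarrow> vectorspace F V \<and> vectorspace F W \<and> f \<in> module_hom F V W"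
    for V W :: "('a, 'v) module" and f
    unfolding linear_map_def mod_hom_def mod_hom_axioms_def vectorspace_def by blast
  show ?thesis
  proof
    fix A :: "('a, 'v) module"
    assume "A \<in> Obj (FinVect F)"
    then have "vectorspace F A" and A: "A \<in> Obj (FinVect F)" by (simp_all add: FinVect_def)
    then interpret vectorspace F A by simp
    have "restrict id (carrier A) \<in> module_hom F A A"
      by (auto simp: module_hom_def)
    then show "Idn (FinVect F) A \<in> homset (FinVect F) A A"
      using A by (simp add: FinVect_def homset_def lin)
  next
    fix f g :: "('a, 'v) linear_arrow" and A B D
    assume f: "f \<in> homset (FinVect F) A B" and g: "g \<in> homset (FinVect F) B D"
    obtain f' where f': "f = (A, f', B)" "f' \<in> module_hom F A B" "vectorspace F A"
      using f by (cases f) (auto simp: FinVect_def homset_def lin)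
    obtain g' where g': "g = (B, g', D)" "g' \<in> module_hom F B D"
      using g by (cases g) (auto simp: FinVect_def homset_def lin)
    interpret vectorspace F A by fact
    have "compose (carrier A) g' f' \<in> module_hom F A D"
      using f'(2) g'(2) by (auto simp: module_hom_def compose_def Pi_iff)
    then show "g \<cdot>\<^bsub>FinVect F\<^esub> f \<in> homset (FinVect F) A D"
      using f g f' g' by (auto simp: FinVect_def homset_def lin)
  next
    fix f :: "('a, 'v) linear_arrow" and A B
    assume f: "f \<in> homset (FinVect F) A B"
    then show "Idn (FinVect F) B \<cdot>\<^bsub>FinVect F\<^esub> f = f"
      by (auto simp: FinVect_def homset_def lin module_hom_def compose_def extensional_def
          fun_eq_iff Pi_iff)
    show "f \<cdot>\<^bsub>FinVect F\<^esub> Idn (FinVect F) A = f"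
      using f by (auto simp: FinVect_def homset_def compose_def extensional_def fun_eq_iff)
  next
    fix f g h :: "('a, 'v) linear_arrow" and A B D E
    assume "f \<in> homset (FinVect F) A B" "g \<in> homset (FinVect F) B D" "h \<in> homset (FinVect F) D E"
    then show "(h \<cdot>\<^bsub>FinVect F\<^esub> g) \<cdot>\<^bsub>FinVect F\<^esub> f = h \<cdot>\<^bsub>FinVect F\<^esub> (g \<cdot>\<^bsub>FinVect F\<^esub> f)"
      by (auto simp: FinVect_def homset_def lin module_hom_def compose_def fun_eq_iff Pi_iff)
  qed (auto simp: FinVect_def)
qed

end

theory Submission
  imports Defs
begin

text \<open>The theorem is a dimension count. Arrows from a one-dimensional space \<open>L\<close> to \<open>V\<close> are the
  elements of \<open>V\<close>, so categorical products and pullbacks in \<open>FinVect F\<close> are products and pullbacks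
  of underlying sets and have the expected dimensions. Every object is a power of \<open>L\<close> and \<open>T\<close>
  preserves products, whence \<open>dim (T V) = k * dim V\<close> with \<open>k = dim (T L)\<close>. As \<open>p\<close> and \<open>T p\<close> are
  split epimorphisms, the pullback \<open>T\<^sub>2 L\<close> has dimension \<open>2 * k - 1\<close>, while universality of the
  vertical lift makes it the pullback of \<open>T p\<close> along \<open>0\<close>, of dimension \<open>k\<^sup>2 - k + 1\<close>. Hence
  \<open>k\<^sup>2 - 3 * k + 2 = 0\<close>, so \<open>k\<close> is \<open>1\<close> or \<open>2\<close>.\<close>


section \<open>Dimensions of vector spaces\<close>

lemma linear_map_iff:
  "linear_map K V W f \<longleftrightarrow> vectorspace K V \<and> vectorspace K W \<and> f \<in> module_hom K V W"
  unfolding linear_map_def mod_hom_def mod_hom_axioms_def vectorspace_def by blast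

text \<open>Independence in the subspace agrees with independence in \<open>V\<close>, so
  independent subsets of \<open>W\<close> have at most \<open>dim\<close> elements. Hence a maximal
  one exists; it is a finite basis of \<open>W\<close>.\<close>

lemma (in vectorspace) fin_dim_subspace:
  assumes W: "subspace K W V" and fd: "fin_dim"
  shows "vectorspace.fin_dim K (vs W)"
proof -
  interpret w: vectorspace K "vs W" using W by (rule subspace_is_vs)
  have sub: "submodule K W V" using W by (simp add: subspace_def)
  have WV: "W \<subseteq> carrier V" using sub by (simp add: submodule_def)
  have small: "finite A \<and> card A \<le> dim" if "A \<subseteq> W \<and> w.lin_indpt A" for A
    using that li_le_dim[OF fd, of A] WV span_li_not_depend(2)[OF _ sub, of A] by auto
  have "{} \<subseteq> W \<and> w.lin_indpt {}"
    by (simp add: w.lin_dep_def)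
  from maximal_exists[of "\<lambda>A. A \<subseteq> W \<and> w.lin_indpt A", OF small this]
  obtain A where "finite A" "maximal A (\<lambda>A. A \<subseteq> W \<and> w.lin_indpt A)" by blast
  then have "finite A" "w.basis A" using w.max_li_is_basis[of A] by auto
  then show ?thesis by (auto simp: w.fin_dim_def w.basis_def)
qed

lemma (in linear_map) rank_nullity_surj:
  assumes "V.fin_dim" and "T ` carrier V = carrier W"
  shows "V.dim = W.dim + vectorspace.dim K (V.vs ker)"
  using rank_nullity[OF assms(1)] surj_imp_imT_carrier[OF assms(2)] by simp

text \<open>Induction on \<open>n\<close>, peeling off the last map: it is surjective, and on its
  kernel the remaining maps are again jointly bijective, so rank-nullity adds one summand.
  \<open>P\<close> varies because the induction hypothesis is applied to that kernel. Only elements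
  and linear maps occur, so the result applies to any categorical product, whatever its carrier
  looks like.\<close>

lemma dim_jointly_bijective:
  fixes n :: nat
  assumes "vectorspace K P" and "vectorspace.fin_dim K P"
    and "\<And>i. i < n \<Longrightarrow> linear_map K P (A i) (\<pi> i)"
    and "\<And>x. (\<And>i. i < n \<Longrightarrow> x i \<in> carrier (A i)) \<Longrightarrow>
      \<exists>!v. v \<in> carrier P \<and> (\<forall>i<n. \<pi> i v = x i)"
  shows "vectorspace.dim K P = (\<Sum>i<n. vectorspace.dim K (A i))"
  using assms
proof (induction n arbitrary: P)
  case 0
  interpret vectorspace K P by fact
  \<comment> \<open>For \<open>n = 0\<close> the condition on the family is vacuous, so any family
    serves, and unique existence says that \<open>P\<close> has exactly one element.\<close>
  have "carrier P = {\<zero>\<^bsub>P\<^esub>}" using "0.prems"(4)[of "\<lambda>_. undefined"] by auto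
  then have "dim = 0" by (intro dim0I) (auto dest: span_closed[rotated] intro: span_zero)
  then show ?case by simp
next
  case (Suc n)
  interpret l: linear_map K P "A n" "\<pi> n" using Suc.prems(3) by simp
  have zero: "\<zero>\<^bsub>A i\<^esub> \<in> carrier (A i)" if "i < Suc n" for i
  proof -
    interpret i: linear_map K P "A i" "\<pi> i" using Suc.prems(3) that by simp
    show ?thesis by simp
  qed
  \<comment> \<open>A preimage of \<open>y\<close> is the element whose last coordinate is
    \<open>y\<close> and whose other coordinates are zero.\<close>
  have "y \<in> \<pi> n ` carrier P" if y: "y \<in> carrier (A n)" for y
  proof -
    have "\<exists>!v. v \<in> carrier P \<and> (\<forall>i<Suc n. \<pi> i v = ((\<lambda>i. \<zero>\<^bsub>A i\<^esub>)(n := y)) i)"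
      using y zero by (intro Suc.prems(4)) auto
    then obtain v where "v \<in> carrier P" "\<pi> n v = y" by auto
    then show ?thesis by blast
  qed
  then have surj: "\<pi> n ` carrier P = carrier (A n)" by auto
  have sub: "subspace K l.ker P" by (rule l.kerT_is_subspace)
  interpret k: vectorspace K "l.V.vs l.ker" using sub by (rule l.V.subspace_is_vs)
  have ker: "v \<in> l.ker \<longleftrightarrow> v \<in> carrier P \<and> \<pi> n v = \<zero>\<^bsub>A n\<^esub>" for v by (simp add: l.ker_def)
  have "k.dim = (\<Sum>i<n. vectorspace.dim K (A i))"
  proof (rule Suc.IH)
    show "vectorspace K (l.V.vs l.ker)" ..
    show "k.fin_dim" by (rule l.V.fin_dim_subspace[OF sub Suc.prems(2)])
    show "linear_map K (l.V.vs l.ker) (A i) (\<pi> i)" if "i < n" for i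
      using that Suc.prems(3)[of i] k.vectorspace_axioms
      by (auto simp: linear_map_iff module_hom_def ker)
    show "\<exists>!v. v \<in> carrier (l.V.vs l.ker) \<and> (\<forall>i<n. \<pi> i v = x i)"
      if "\<And>i. i < n \<Longrightarrow> x i \<in> carrier (A i)" for x
    proof -
      have "\<exists>!v. v \<in> carrier P \<and> (\<forall>i<Suc n. \<pi> i v = (x(n := \<zero>\<^bsub>A n\<^esub>)) i)"
        using that by (intro Suc.prems(4)) auto
      \<comment> \<open>Membership in the kernel is the condition that the last coordinate vanishes,
        so extending \<open>x\<close> by zero turns unique existence in \<open>P\<close> into unique
        existence in the kernel.\<close>
      moreover have "v \<in> carrier P \<and> (\<forall>i<Suc n. \<pi> i v = (x(n := \<zero>\<^bsub>A n\<^esub>)) i) \<longleftrightarrow>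
          v \<in> carrier (l.V.vs l.ker) \<and> (\<forall>i<n. \<pi> i v = x i)" for v
        by (auto simp: ker less_Suc_eq)
      ultimately show ?thesis by simp
    qed
  qed
  then show ?case using l.rank_nullity_surj[OF Suc.prems(2) surj] by simp
qed

text \<open>The base change \<open>l\<close> of the surjection \<open>r\<close> is surjective, and
  \<open>t\<close> restricts to a bijection from the kernel of \<open>l\<close> to the kernel of
  \<open>r\<close>. Comparing rank-nullity for \<open>l\<close> and for \<open>r\<close> gives the
  formula, which is stated additively to avoid subtraction of natural numbers.\<close>

lemma dim_pullback:
  assumes t: "linear_map K P X t" and l: "linear_map K P Z l"
    and r: "linear_map K X Y r" and b: "linear_map K Z Y b"
    and fd: "vectorspace.fin_dim K P" "vectorspace.fin_dim K X"
    and surj: "r ` carrier X = carrier Y"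
    and comm: "\<And>v. v \<in> carrier P \<Longrightarrow> r (t v) = b (l v)"
    and univ: "\<And>x z. x \<in> carrier X \<Longrightarrow> z \<in> carrier Z \<Longrightarrow> r x = b z \<Longrightarrow>
      \<exists>!v. v \<in> carrier P \<and> t v = x \<and> l v = z"
  shows "vectorspace.dim K P + vectorspace.dim K Y = vectorspace.dim K X + vectorspace.dim K Z"
proof -
  interpret t: linear_map K P X t by fact
  interpret l: linear_map K P Z l by fact
  interpret r: linear_map K X Y r by fact
  interpret b: linear_map K Z Y b by fact
  have "z \<in> l ` carrier P" if z: "z \<in> carrier Z" for z
  proof -
    have "b z \<in> r ` carrier X" using z surj by simp
    then obtain x where "x \<in> carrier X" "r x = b z" by auto
    with univ[of x z] z show ?thesis by (auto simp: image_iff)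
  qed
  then have l_surj: "l ` carrier P = carrier Z" by auto
  have kl: "v \<in> l.ker \<longleftrightarrow> v \<in> carrier P \<and> l v = \<zero>\<^bsub>Z\<^esub>" for v by (simp add: l.ker_def)
  have kr: "v \<in> r.ker \<longleftrightarrow> v \<in> carrier X \<and> r v = \<zero>\<^bsub>Y\<^esub>" for v by (simp add: r.ker_def)
  have to_kr: "t v \<in> r.ker" if "v \<in> l.ker" for v using that comm[of v] by (simp add: kl kr)
  have subl: "subspace K l.ker P" by (rule l.kerT_is_subspace)
  have subr: "subspace K r.ker X" by (rule r.kerT_is_subspace)
  interpret k: linear_map K "P\<lparr>carrier := l.ker\<rparr>" "X\<lparr>carrier := r.ker\<rparr>" t
    using vectorspace.subspace_is_vs[OF _ subl] vectorspace.subspace_is_vs[OF _ subr] to_kr l r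
    by (auto simp: linear_map_iff module_hom_def kl)
  \<comment> \<open>This is \<open>univ\<close> over the zero of \<open>Z\<close>: for
    \<open>x\<close> in the kernel of \<open>r\<close>, both \<open>r x\<close> and the image of
    that zero under \<open>b\<close> vanish.\<close>
  have ex1: "\<exists>!v. v \<in> l.ker \<and> t v = x" if "x \<in> r.ker" for x
    using that univ[of x "\<zero>\<^bsub>Z\<^esub>"] by (auto simp: kl kr)
  have "k.V.dim = k.W.dim"
  proof (rule k.dim_eq)
    show "k.V.fin_dim" using vectorspace.fin_dim_subspace[OF _ subl fd(1)] l
      by (simp add: linear_map_iff)
    show "inj_on t (carrier (P\<lparr>carrier := l.ker\<rparr>))"
    proof (rule inj_onI)
      fix v w assume "v \<in> carrier (P\<lparr>carrier := l.ker\<rparr>)" "w \<in> carrier (P\<lparr>carrier := l.ker\<rparr>)"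
        and eq: "t v = t w"
      then have "v \<in> l.ker" "w \<in> l.ker" by simp_all
      then show "v = w" using ex1[OF to_kr, of v] eq by metis
    qed
    show "t ` carrier (P\<lparr>carrier := l.ker\<rparr>) = carrier (X\<lparr>carrier := r.ker\<rparr>)"
      using ex1 to_kr by (auto simp: image_iff) metis
  qed
  then show ?thesis
    using l.rank_nullity_surj[OF fd(1) l_surj] r.rank_nullity_surj[OF fd(2) surj] by simp
qed

lemma linear_map_inv_into:
  assumes f: "linear_map K V W f" and bij: "bij_betw f (carrier V) (carrier W)"
  shows "linear_map K W V (inv_into (carrier V) f)"
proof -
  interpret linear_map K V W f by fact
  let ?g = "inv_into (carrier V) f"
  have g: "?g y \<in> carrier V" "f (?g y) = y" if "y \<in> carrier W" for y
    using that bij by (auto simp: bij_betw_def inv_into_into f_inv_into_f)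
  have eq: "?g y = x" if "x \<in> carrier V" "f x = y" for x y
    using that bij by (auto simp: bij_betw_def)
  show ?thesis
    using f by (auto simp: linear_map_iff module_hom_def g intro!: eq)
qed

lemma linear_map_comp:
  assumes "linear_map K U V f" and "linear_map K V W g"
  shows "linear_map K U W (g \<circ> f)"
  using assms by (auto simp: linear_map_iff module_hom_def Pi_iff)

text \<open>Choose bases \<open>A\<close> and \<open>B\<close>. The bijection reads off coordinates
  with respect to \<open>A\<close>, reindexes them by a bijection of the bases, and forms the linear
  combination over \<open>B\<close>.\<close>

lemma linear_bijection_if_dim_eq:
  assumes V: "vectorspace K V" "vectorspace.fin_dim K V"
    and W: "vectorspace K W" "vectorspace.fin_dim K W"
    and dim: "vectorspace.dim K V = vectorspace.dim K W"
  shows "\<exists>f. linear_map K V W f \<and> bij_betw f (carrier V) (carrier W)"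
proof -
  interpret V: vectorspace K V by fact
  interpret W: vectorspace K W by fact
  obtain A where A: "finite A" "V.basis A" using V.finite_basis_exists V(2) by blast
  obtain B where B: "finite B" "W.basis B" using W.finite_basis_exists W(2) by blast
  have AV: "A \<subseteq> carrier V" and BW: "B \<subseteq> carrier W"
    using A B by (auto simp: V.basis_def W.basis_def)
  have "card B = card A" using dim V.dim_basis[OF A] W.dim_basis[OF B] by simp
  then obtain h where h: "bij_betw h B A" using A B finite_same_card_bij by blast
  \<comment> \<open>Reindexing is precomposition, hence contravariant; this is why \<open>h\<close>
    runs from \<open>B\<close> to \<open>A\<close>. The restriction keeps coordinate functions
    extensional.\<close>
  let ?\<phi> = "\<lambda>a. V.lincomb a A" and ?\<psi> = "\<lambda>a. W.lincomb a B"
  let ?\<rho> = "\<lambda>a. restrict (a \<circ> h) B"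
  have \<phi>: "linear_map K (V.func_space A) V ?\<phi>" by (rule V.lincomb_is_linear[OF A(1) AV])
  have \<psi>: "linear_map K (V.func_space B) W ?\<psi>" by (rule W.lincomb_is_linear[OF B(1) BW])
  have hB: "h x \<in> A" if "x \<in> B" for x using that h by (auto simp: bij_betw_def)
  have \<rho>: "linear_map K (V.func_space A) (V.func_space B) ?\<rho>"
    using V.func_space_is_vs[of A] V.func_space_is_vs[of B] hB
    by (auto simp: linear_map_iff module_hom_def V.func_space_def fun_eq_iff)
  have carr: "carrier (V.func_space S) = S \<rightarrow>\<^sub>E carrier K" for S :: "'z set"
    by (simp add: V.func_space_def)
  have bij\<phi>: "bij_betw ?\<phi> (carrier (V.func_space A)) (carrier V)"
  proof -
    have "\<forall>v \<in> carrier V. \<exists>!a. a \<in> carrier (V.func_space A) \<and> ?\<phi> a = v"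
      using V.basis_criterion[OF A(1) AV] A(2) by (simp add: carr)
    moreover have "?\<phi> ` carrier (V.func_space A) \<subseteq> carrier V"
      using AV by (auto simp: carr PiE_def)
    ultimately show ?thesis by (auto simp: bij_betw_def inj_on_def image_iff)
  qed
  have bij\<psi>: "bij_betw ?\<psi> (carrier (V.func_space B)) (carrier W)"
  proof -
    have "\<forall>v \<in> carrier W. \<exists>!a. a \<in> carrier (V.func_space B) \<and> ?\<psi> a = v"
      using W.basis_criterion[OF B(1) BW] B(2) by (simp add: carr)
    moreover have "?\<psi> ` carrier (V.func_space B) \<subseteq> carrier W"
      using BW by (auto simp: carr PiE_def)
    ultimately show ?thesis by (auto simp: bij_betw_def inj_on_def image_iff)
  qed
  have bij\<rho>: "bij_betw ?\<rho> (carrier (V.func_space A)) (carrier (V.func_space B))"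
  proof (rule bij_betw_byWitness[where f' = "\<lambda>b. restrict (b \<circ> inv_into B h) A"])
    have hA: "inv_into B h x \<in> B" "h (inv_into B h x) = x" if "x \<in> A" for x
      using that h by (auto simp: bij_betw_def inv_into_into f_inv_into_f)
    have hh: "inv_into B h (h x) = x" if "x \<in> B" for x
      using that h by (auto simp: bij_betw_def)
    show "\<forall>a\<in>carrier (V.func_space A). restrict (?\<rho> a \<circ> inv_into B h) A = a"
      by (auto simp: carr hA fun_eq_iff PiE_def extensional_def)
    show "\<forall>b\<in>carrier (V.func_space B). ?\<rho> (restrict (b \<circ> inv_into B h) A) = b"
      by (auto simp: carr hB hh fun_eq_iff PiE_def extensional_def)
    show "?\<rho> ` carrier (V.func_space A) \<subseteq> carrier (V.func_space B)"
      by (auto simp: carr hB)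
    show "(\<lambda>b. restrict (b \<circ> inv_into B h) A) ` carrier (V.func_space B)
        \<subseteq> carrier (V.func_space A)"
      by (auto simp: carr hA)
  qed
  let ?f = "?\<psi> \<circ> (?\<rho> \<circ> inv_into (carrier (V.func_space A)) ?\<phi>)"
  have "linear_map K V W ?f"
    by (intro linear_map_comp[OF _ \<psi>] linear_map_comp[OF _ \<rho>] linear_map_inv_into[OF \<phi> bij\<phi>])
  moreover have "bij_betw ?f (carrier V) (carrier W)"
    by (intro bij_betw_trans[OF _ bij\<psi>] bij_betw_trans[OF _ bij\<rho>] bij_betw_inv_into[OF bij\<phi>])
  ultimately show ?thesis by blast
qed


section \<open>Arrows of finite-dimensional vector spaces\<close>

definition arrow_fun :: "('a, 'v) linear_arrow \<Rightarrow> 'v \<Rightarrow> 'v" where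
  "arrow_fun f = fst (snd f)"

lemma homset_FinVect_iff:
  "f \<in> homset (FinVect F) V W \<longleftrightarrow>
    V \<in> Obj (FinVect F) \<and> W \<in> Obj (FinVect F) \<and> f = (V, arrow_fun f, W) \<and>
    linear_map F V W (arrow_fun f) \<and> arrow_fun f \<in> extensional (carrier V)"
  by (cases f) (auto simp: homset_def FinVect_def arrow_fun_def)

lemma Obj_FinVect: "V \<in> Obj (FinVect F) \<longleftrightarrow> vectorspace F V \<and> vectorspace.fin_dim F V"
  by (simp add: FinVect_def)

lemma homset_linear_map: "f \<in> homset (FinVect F) V W \<Longrightarrow> linear_map F V W (arrow_fun f)"
  by (simp add: homset_FinVect_iff)

lemma arrow_fun_carrier:
  "f \<in> homset (FinVect F) V W \<Longrightarrow> v \<in> carrier V \<Longrightarrow> arrow_fun f v \<in> carrier W"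
  using homset_linear_map mod_hom.f_im unfolding linear_map_def by fast

lemma arrow_fun_Cmp:
  assumes "f \<in> homset (FinVect F) U V" "g \<in> homset (FinVect F) V W" "v \<in> carrier U"
  shows "arrow_fun (g \<cdot>\<^bsub>FinVect F\<^esub> f) v = arrow_fun g (arrow_fun f v)"
  using assms
  by (cases f, cases g) (auto simp: homset_def FinVect_def arrow_fun_def compose_def)

lemma arrow_fun_Idn: "v \<in> carrier V \<Longrightarrow> arrow_fun (Idn (FinVect F) V) v = v"
  by (simp add: FinVect_def arrow_fun_def)

lemma arrow_eqI:
  assumes "f \<in> homset (FinVect F) V W" "g \<in> homset (FinVect F) V W"
    and "\<And>v. v \<in> carrier V \<Longrightarrow> arrow_fun f v = arrow_fun g v"
  shows "f = g"
proof -
  have "arrow_fun f = arrow_fun g"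
    using assms by (intro extensionalityI[of _ "carrier V"]) (auto simp: homset_FinVect_iff)
  then show ?thesis using assms unfolding homset_FinVect_iff by metis
qed

lemma restrict_homset:
  assumes "V \<in> Obj (FinVect F)" "W \<in> Obj (FinVect F)" "linear_map F V W f"
  shows "(V, restrict f (carrier V), W) \<in> homset (FinVect F) V W"
proof -
  interpret linear_map F V W f by fact
  show ?thesis
    using assms by (auto simp: homset_FinVect_iff arrow_fun_def linear_map_iff module_hom_def)
qed

text \<open>An invertible arrow has a bijective underlying map, so dimensions agree. Conversely,
  equal dimensions give a linear bijection, whose set-theoretic inverse is linear. This reduces the
  theorem to arithmetic of dimensions.\<close>

lemma isomorphic_obj_iff_dim:
  assumes V: "V \<in> Obj (FinVect F)" and W: "W \<in> Obj (FinVect F)"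
  shows "isomorphic_obj (FinVect F) V W \<longleftrightarrow> vectorspace.dim F V = vectorspace.dim F W"
proof
  assume "isomorphic_obj (FinVect F) V W"
  then obtain f g where f: "f \<in> homset (FinVect F) V W" and g: "g \<in> homset (FinVect F) W V"
    and gf: "g \<cdot>\<^bsub>FinVect F\<^esub> f = Idn (FinVect F) V" and fg: "f \<cdot>\<^bsub>FinVect F\<^esub> g = Idn (FinVect F) W"
    by (auto simp: isomorphic_obj_def)
  have "bij_betw (arrow_fun f) (carrier V) (carrier W)"
    using arrow_fun_Cmp[OF f g] arrow_fun_Cmp[OF g f] arrow_fun_carrier[OF f] arrow_fun_carrier[OF g]
    by (intro bij_betw_byWitness[where f' = "arrow_fun g"]) (auto simp: gf fg arrow_fun_Idn)
  then show "vectorspace.dim F V = vectorspace.dim F W"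
    using linear_map.dim_eq[OF homset_linear_map[OF f]] V by (simp add: bij_betw_def Obj_FinVect)
next
  assume "vectorspace.dim F V = vectorspace.dim F W"
  then obtain f where f: "linear_map F V W f" and bij: "bij_betw f (carrier V) (carrier W)"
    using linear_bijection_if_dim_eq V W by (metis Obj_FinVect)
  let ?g = "inv_into (carrier V) f"
  have g: "linear_map F W V ?g" by (rule linear_map_inv_into[OF f bij])
  \<comment> \<open>Arrows are extensional, so both maps are restricted to their domains.\<close>
  let ?f' = "(V, restrict f (carrier V), W)" and ?g' = "(W, restrict ?g (carrier W), V)"
  have f': "?f' \<in> homset (FinVect F) V W" and g': "?g' \<in> homset (FinVect F) W V"
    using restrict_homset V W f g by blast+
  interpret category "FinVect F" by (rule FinVect_category)
  have fc: "f v \<in> carrier W" "?g (f v) = v" if "v \<in> carrier V" for v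
    using that bij by (auto simp: bij_betw_def)
  have gc: "?g w \<in> carrier V" "f (?g w) = w" if "w \<in> carrier W" for w
    using that bij by (auto simp: bij_betw_def inv_into_into f_inv_into_f)
  have "?g' \<cdot>\<^bsub>FinVect F\<^esub> ?f' = Idn (FinVect F) V"
    by (rule arrow_eqI[OF cmp_hom[OF f' g'] idn_hom[OF V]])
      (simp add: arrow_fun_Cmp[OF f' g'] arrow_fun_Idn, simp add: arrow_fun_def fc)
  moreover have "?f' \<cdot>\<^bsub>FinVect F\<^esub> ?g' = Idn (FinVect F) W"
    by (rule arrow_eqI[OF cmp_hom[OF g' f'] idn_hom[OF W]])
      (simp add: arrow_fun_Cmp[OF g' f'] arrow_fun_Idn, simp add: arrow_fun_def gc)
  ultimately show "isomorphic_obj (FinVect F) V W"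
    using f' g' unfolding isomorphic_obj_def by blast
qed

section \<open>Universal properties tested on arrows from a line\<close>

lemma product_universal:
  assumes "is_product C n A P \<pi>" "Z \<in> Obj C" "\<And>i. i < n \<Longrightarrow> x i \<in> homset C Z (A i)"
  shows "\<exists>!h. h \<in> homset C Z P \<and> (\<forall>i<n. \<pi> i \<cdot>\<^bsub>C\<^esub> h = x i)"
  using assms unfolding is_product_def by simp

lemma pullback_universal:
  assumes "is_pullback C t l r b" "Z \<in> Obj C"
    and "u \<in> homset C Z (Dom C r)" "v \<in> homset C Z (Dom C b)" "r \<cdot>\<^bsub>C\<^esub> u = b \<cdot>\<^bsub>C\<^esub> v"
  shows "\<exists>!h. h \<in> homset C Z (Dom C t) \<and> t \<cdot>\<^bsub>C\<^esub> h = u \<and> l \<cdot>\<^bsub>C\<^esub> h = v"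
  using assms unfolding is_pullback_def by blast

lemma fibre_power_universal:
  assumes "is_fibre_power C p n P q \<pi>" "Z \<in> Obj C" "r \<in> homset C Z (Cod C p)"
    and "\<And>i. i < n \<Longrightarrow> x i \<in> homset C Z (Dom C p) \<and> p \<cdot>\<^bsub>C\<^esub> x i = r"
  shows "\<exists>!h. h \<in> homset C Z P \<and> q \<cdot>\<^bsub>C\<^esub> h = r \<and> (\<forall>i<n. \<pi> i \<cdot>\<^bsub>C\<^esub> h = x i)"
  using assms unfolding is_fibre_power_def by simp

text \<open>A one-dimensional space with a chosen generator \<open>e\<close>. Evaluation at
  \<open>e\<close> identifies arrows from \<open>L\<close> to \<open>V\<close> with elements of
  \<open>V\<close>; unique coordinates are assumed instead of dimension one because they define the
  inverse of this evaluation directly.\<close>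

locale line =
  fixes F :: "('a, 'k) ring_scheme" and L :: "('a, 'v) module" and e :: 'v
  assumes L_obj: "L \<in> Obj (FinVect F)"
    and e_L: "e \<in> carrier L"
    and coordinate: "x \<in> carrier L \<Longrightarrow> \<exists>!a. a \<in> carrier F \<and> x = a \<odot>\<^bsub>L\<^esub> e"
begin

sublocale FinVect: category "FinVect F" by (rule FinVect_category)

sublocale L: vectorspace F L using L_obj by (simp add: Obj_FinVect)

lemma dim_L: "L.dim = 1"
proof (rule L.dim1I)
  show "e \<noteq> \<zero>\<^bsub>L\<^esub>"
  proof
    assume e: "e = \<zero>\<^bsub>L\<^esub>"
    \<comment> \<open>If \<open>e\<close> were zero, both one and zero would be coordinates of the
      zero vector, against uniqueness.\<close>
    have "\<one>\<^bsub>F\<^esub> = \<zero>\<^bsub>F\<^esub>"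
      using coordinate[of "\<zero>\<^bsub>L\<^esub>"] L.smult_r_null[of "\<one>\<^bsub>F\<^esub>"] L.smult_r_null[of "\<zero>\<^bsub>F\<^esub>"]
      unfolding e by (metis L.R.one_closed L.R.zero_closed L.M.zero_closed)
    then show False by simp
  qed
  have "x \<in> L.span {e}" if x: "x \<in> carrier L" for x
  proof -
    obtain a where a: "a \<in> carrier F" "x = a \<odot>\<^bsub>L\<^esub> e" using coordinate[OF x] by blast
    have "submodule F (L.span {e}) L" using e_L by (intro L.span_is_submodule) simp
    then show ?thesis
      using a e_L L.in_own_span[of "{e}"] by (simp add: submodule.smult_closed)
  qed
  then show "L.gen_set {e}" using e_L L.span_is_subset2[of "{e}"] by auto
qed (rule e_L)

definition coord :: "'v \<Rightarrow> 'a" where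
  "coord x = (THE a. a \<in> carrier F \<and> x = a \<odot>\<^bsub>L\<^esub> e)"

lemma coord: "x \<in> carrier L \<Longrightarrow> coord x \<in> carrier F" "x \<in> carrier L \<Longrightarrow> coord x \<odot>\<^bsub>L\<^esub> e = x"
  using theI'[OF coordinate, of x] by (auto simp: coord_def)

lemma coord_eq: "a \<in> carrier F \<Longrightarrow> coord (a \<odot>\<^bsub>L\<^esub> e) = a"
  using coordinate[of "a \<odot>\<^bsub>L\<^esub> e"] coord[of "a \<odot>\<^bsub>L\<^esub> e"] e_L by auto

text \<open>The arrow from \<open>L\<close> that represents the element \<open>v\<close>, namely the
  linear map sending \<open>e\<close> to \<open>v\<close>.\<close>

definition pt :: "('a, 'v) module \<Rightarrow> 'v \<Rightarrow> ('a, 'v) linear_arrow" where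
  "pt V v = (L, restrict (\<lambda>x. coord x \<odot>\<^bsub>V\<^esub> v) (carrier L), V)"

text \<open>By uniqueness of coordinates \<open>coord\<close> is itself linear, and scaling a fixed
  vector is linear in the scalar.\<close>

lemma pt_hom:
  assumes V: "V \<in> Obj (FinVect F)" and v: "v \<in> carrier V"
  shows "pt V v \<in> homset (FinVect F) L V"
proof -
  interpret V: vectorspace F V using V by (simp add: Obj_FinVect)
  have add: "coord (x \<oplus>\<^bsub>L\<^esub> y) = coord x \<oplus>\<^bsub>F\<^esub> coord y" if "x \<in> carrier L" "y \<in> carrier L" for x y
    using that coord_eq[of "coord x \<oplus>\<^bsub>F\<^esub> coord y"] e_L by (simp add: coord L.smult_l_distr)
  have smult: "coord (a \<odot>\<^bsub>L\<^esub> x) = a \<otimes>\<^bsub>F\<^esub> coord x" if "a \<in> carrier F" "x \<in> carrier L" for a x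
    using that coord_eq[of "a \<otimes>\<^bsub>F\<^esub> coord x"] e_L by (simp add: coord L.smult_assoc1)
  have "linear_map F L V (\<lambda>x. coord x \<odot>\<^bsub>V\<^esub> v)"
    using v L.vectorspace_axioms V.vectorspace_axioms
    by (auto simp: linear_map_iff module_hom_def add smult coord V.smult_l_distr V.smult_assoc1)
  then show ?thesis unfolding pt_def by (rule restrict_homset[OF L_obj V])
qed

lemma pt_e: "V \<in> Obj (FinVect F) \<Longrightarrow> v \<in> carrier V \<Longrightarrow> arrow_fun (pt V v) e = v"
  using coord_eq[of "\<one>\<^bsub>F\<^esub>"] e_L module.smult_one[of F V v]
  by (simp add: pt_def arrow_fun_def Obj_FinVect vectorspace_def)

text \<open>Linearity lets the scalar \<open>coord x\<close> pass through \<open>f\<close>. This is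
  naturality of the correspondence between elements and arrows from \<open>L\<close>, and turns
  equations between elements into equations between arrows.\<close>

lemma Cmp_pt:
  assumes f: "f \<in> homset (FinVect F) V W" and v: "v \<in> carrier V"
  shows "f \<cdot>\<^bsub>FinVect F\<^esub> pt V v = pt W (arrow_fun f v)"
proof -
  have V: "V \<in> Obj (FinVect F)" and W: "W \<in> Obj (FinVect F)"
    using f by (auto simp: homset_FinVect_iff)
  interpret linear_map F V W "arrow_fun f" using f by (rule homset_linear_map)
  show ?thesis
  proof (rule arrow_eqI)
    show "f \<cdot>\<^bsub>FinVect F\<^esub> pt V v \<in> homset (FinVect F) L W"
      by (rule FinVect.cmp_hom[OF pt_hom[OF V v] f])
    show "pt W (arrow_fun f v) \<in> homset (FinVect F) L W"
      using W v by (simp add: pt_hom)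
    show "arrow_fun (f \<cdot>\<^bsub>FinVect F\<^esub> pt V v) x = arrow_fun (pt W (arrow_fun f v)) x"
      if "x \<in> carrier L" for x
    proof -
      have "arrow_fun (pt U u) x = coord x \<odot>\<^bsub>U\<^esub> u" for U u
        using that by (simp add: pt_def arrow_fun_def)
      then show ?thesis using arrow_fun_Cmp[OF pt_hom[OF V v] f that] that v coord(1) by simp
    qed
  qed
qed

text \<open>The elements \<open>x i\<close> form a cone with vertex \<open>L\<close>; its mediating
  arrow, evaluated at \<open>e\<close>, is the required element. Two solutions represent two
  mediating arrows for this cone, which coincide, and evaluation at \<open>e\<close> recovers the
  solutions.\<close>

lemma product_elements:
  fixes P :: "('a, 'v) module"
  assumes P: "is_product (FinVect F) n A P \<pi>" and x: "\<And>i. i < n \<Longrightarrow> x i \<in> carrier (A i)"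
  shows "\<exists>!v. v \<in> carrier P \<and> (\<forall>i<n. arrow_fun (\<pi> i) v = x i)"
proof -
  have PO: "P \<in> Obj (FinVect F)" using P by (simp add: is_product_def)
  have A: "A i \<in> Obj (FinVect F)" "\<pi> i \<in> homset (FinVect F) P (A i)" if "i < n" for i
    using P that by (simp_all add: is_product_def)
  have ex1: "\<exists>!h. h \<in> homset (FinVect F) L P \<and>
      (\<forall>i<n. \<pi> i \<cdot>\<^bsub>FinVect F\<^esub> h = pt (A i) (x i))"
    by (rule product_universal[OF P L_obj pt_hom[OF A(1) x]])
  then obtain h where h: "h \<in> homset (FinVect F) L P"
      "\<And>i. i < n \<Longrightarrow> \<pi> i \<cdot>\<^bsub>FinVect F\<^esub> h = pt (A i) (x i)" by blast
  show ?thesis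
  proof (rule ex_ex1I)
    have "arrow_fun (\<pi> i) (arrow_fun h e) = x i" if "i < n" for i
      using arrow_fun_Cmp[OF h(1) A(2)[OF that] e_L] h(2)[OF that] pt_e[OF A(1) x, OF that that]
      by simp
    then show "\<exists>v. v \<in> carrier P \<and> (\<forall>i<n. arrow_fun (\<pi> i) v = x i)"
      using arrow_fun_carrier[OF h(1) e_L] by blast
    fix v w
    assume vw: "v \<in> carrier P \<and> (\<forall>i<n. arrow_fun (\<pi> i) v = x i)"
      "w \<in> carrier P \<and> (\<forall>i<n. arrow_fun (\<pi> i) w = x i)"
    have "pt P u \<in> homset (FinVect F) L P \<and>
        (\<forall>i<n. \<pi> i \<cdot>\<^bsub>FinVect F\<^esub> pt P u = pt (A i) (x i))"
      if "u \<in> carrier P \<and> (\<forall>i<n. arrow_fun (\<pi> i) u = x i)" for u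
      using that pt_hom[OF PO, of u] Cmp_pt[OF A(2), of _ u] by simp
    note hom = this
    have "pt P v = pt P w"
      by (rule trans[OF the1_equality[OF ex1 hom[OF vw(1)], symmetric]
            the1_equality[OF ex1 hom[OF vw(2)]]])
    then have "arrow_fun (pt P v) e = arrow_fun (pt P w) e" by (simp only:)
    then show "v = w" using vw by (simp only: pt_e[OF PO])
  qed
qed

lemma dim_product:
  fixes P :: "('a, 'v) module"
  assumes P: "is_product (FinVect F) n A P \<pi>"
  shows "vectorspace.dim F P = (\<Sum>i<n. vectorspace.dim F (A i))"
proof -
  have V: "vectorspace F P" "vectorspace.fin_dim F P"
    using P by (simp_all add: is_product_def Obj_FinVect)
  have lin: "linear_map F P (A i) (arrow_fun (\<pi> i))" if "i < n" for i
    using P that by (intro homset_linear_map) (simp add: is_product_def)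
  have ex1: "\<exists>!v. v \<in> carrier P \<and> (\<forall>i<n. arrow_fun (\<pi> i) v = x i)"
    if "\<And>i. i < n \<Longrightarrow> x i \<in> carrier (A i)" for x
    by (rule product_elements[where x = x, OF P that])
  show ?thesis
    by (rule dim_jointly_bijective[where \<pi> = "\<lambda>i. arrow_fun (\<pi> i)" and A = A, OF V lin ex1])
qed

text \<open>Testing the square on arrows from \<open>L\<close> makes it a pullback of underlying
  sets, as for products. The section \<open>s\<close> is there to make \<open>r\<close>
  surjective.\<close>

lemma dim_pullback_FinVect:
  fixes U :: "('a, 'v) module"
  assumes P: "is_pullback (FinVect F) t l r b"
    and t: "t \<in> homset (FinVect F) U X" and l: "l \<in> homset (FinVect F) U Z"
    and r: "r \<in> homset (FinVect F) X Y" and b: "b \<in> homset (FinVect F) Z Y"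
    and s: "s \<in> homset (FinVect F) Y X" "r \<cdot>\<^bsub>FinVect F\<^esub> s = Idn (FinVect F) Y"
  shows "vectorspace.dim F U + vectorspace.dim F Y = vectorspace.dim F X + vectorspace.dim F Z"
proof (rule dim_pullback[of F U X "arrow_fun t" Z "arrow_fun l" Y "arrow_fun r" "arrow_fun b"])
  have O: "U \<in> Obj (FinVect F)" "X \<in> Obj (FinVect F)" "Y \<in> Obj (FinVect F)" "Z \<in> Obj (FinVect F)"
    using t r b by (auto simp: homset_FinVect_iff)
  have D: "Dom (FinVect F) t = U" "Dom (FinVect F) r = X" "Dom (FinVect F) b = Z"
    using t r b by (auto simp: homset_def)
  show "linear_map F U X (arrow_fun t)" "linear_map F U Z (arrow_fun l)"
    "linear_map F X Y (arrow_fun r)" "linear_map F Z Y (arrow_fun b)"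
    using t l r b by (auto intro: homset_linear_map)
  show "vectorspace.fin_dim F U" "vectorspace.fin_dim F X" using O by (auto simp: Obj_FinVect)
  show "arrow_fun r ` carrier X = carrier Y"
    using arrow_fun_carrier[OF r] arrow_fun_carrier[OF s(1)] arrow_fun_Cmp[OF s(1) r]
    by (force simp: s(2) arrow_fun_Idn)
  have comm: "r \<cdot>\<^bsub>FinVect F\<^esub> t = b \<cdot>\<^bsub>FinVect F\<^esub> l" using P by (simp add: is_pullback_def)
  then show "arrow_fun r (arrow_fun t v) = arrow_fun b (arrow_fun l v)" if "v \<in> carrier U" for v
    using arrow_fun_Cmp[OF t r that] arrow_fun_Cmp[OF l b that] by simp
  show "\<exists>!v. v \<in> carrier U \<and> arrow_fun t v = x \<and> arrow_fun l v = z"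
    if x: "x \<in> carrier X" and z: "z \<in> carrier Z" and xz: "arrow_fun r x = arrow_fun b z" for x z
  proof -
    \<comment> \<open>A compatible pair of elements becomes a compatible pair of arrows from
      \<open>L\<close>.\<close>
    have ptx: "pt X x \<in> homset (FinVect F) L X" and ptz: "pt Z z \<in> homset (FinVect F) L Z"
      using pt_hom O x z by auto
    have "r \<cdot>\<^bsub>FinVect F\<^esub> pt X x = b \<cdot>\<^bsub>FinVect F\<^esub> pt Z z"
      using Cmp_pt[OF r x] Cmp_pt[OF b z] xz by simp
    with pullback_universal[OF P L_obj, of "pt X x" "pt Z z"] ptx ptz
    have ex1: "\<exists>!h. h \<in> homset (FinVect F) L U \<and>
        t \<cdot>\<^bsub>FinVect F\<^esub> h = pt X x \<and> l \<cdot>\<^bsub>FinVect F\<^esub> h = pt Z z"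
      by (simp add: D)
    then obtain h where h: "h \<in> homset (FinVect F) L U"
        "t \<cdot>\<^bsub>FinVect F\<^esub> h = pt X x" "l \<cdot>\<^bsub>FinVect F\<^esub> h = pt Z z" by blast
    show ?thesis
    proof (rule ex_ex1I)
      show "\<exists>v. v \<in> carrier U \<and> arrow_fun t v = x \<and> arrow_fun l v = z"
        using arrow_fun_carrier[OF h(1) e_L] arrow_fun_Cmp[OF h(1) t e_L]
          arrow_fun_Cmp[OF h(1) l e_L] h(2,3) pt_e[OF O(2) x] pt_e[OF O(4) z] by auto
      fix v w
      assume vw: "v \<in> carrier U \<and> arrow_fun t v = x \<and> arrow_fun l v = z"
        "w \<in> carrier U \<and> arrow_fun t w = x \<and> arrow_fun l w = z"
      have "pt U y \<in> homset (FinVect F) L U \<and>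
          t \<cdot>\<^bsub>FinVect F\<^esub> pt U y = pt X x \<and> l \<cdot>\<^bsub>FinVect F\<^esub> pt U y = pt Z z"
        if "y \<in> carrier U \<and> arrow_fun t y = x \<and> arrow_fun l y = z" for y
        using that pt_hom[OF O(1), of y] Cmp_pt[OF t, of y] Cmp_pt[OF l, of y] by simp
      note hom = this
      have "pt U v = pt U w"
        by (rule trans[OF the1_equality[OF ex1 hom[OF vw(1)], symmetric]
              the1_equality[OF ex1 hom[OF vw(2)]]])
      then have "arrow_fun (pt U v) e = arrow_fun (pt U w) e" by (simp only:)
      then show "v = w" using vw by (simp only: pt_e[OF O(1)])
    qed
  qed
qed

text \<open>Since \<open>L\<close> has dimension one, its power with exponent \<open>dim V\<close>
  has the dimension of \<open>V\<close>. The power comes from the existence of finite products, so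
  no carrier inside \<open>'v\<close> has to be constructed.\<close>

lemma isomorphic_power_L:
  fixes V :: "('a, 'v) module"
  assumes "has_finite_products (FinVect F :: (('a, 'v) module, ('a, 'v) linear_arrow) precategory)"
    and V: "V \<in> Obj (FinVect F)"
  obtains P \<pi> where "is_product (FinVect F) (vectorspace.dim F V) (\<lambda>_. L) P \<pi>"
    and "isomorphic_obj (FinVect F) V P"
proof -
  have "\<exists>P \<pi>. is_product (FinVect F) (vectorspace.dim F V) (\<lambda>_. L) P \<pi>"
    using assms(1) L_obj by (simp add: has_finite_products_def)
  then obtain P \<pi> where P: "is_product (FinVect F) (vectorspace.dim F V) (\<lambda>_. L) P \<pi>"
    by blast
  moreover have "isomorphic_obj (FinVect F) V P"
    using dim_product[OF P] dim_L P V by (simp add: isomorphic_obj_iff_dim is_product_def)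
  ultimately show ?thesis using that by blast
qed

end

section \<open>Existence of a line, functors on isomorphisms, and fibre squares\<close>

lemma line_exists:
  fixes F :: "('a, 'k) ring_scheme" and emb :: "'a \<Rightarrow> 'v"
  assumes "field F" and inj: "inj_on emb (carrier F)"
  shows "\<exists>(L :: ('a, 'v) module) e. line F L e"
proof -
  interpret field F by fact
  \<comment> \<open>\<open>L\<close> is the field as a space over itself, transported along
    \<open>emb\<close>; \<open>d\<close> decodes elements of the image back into scalars.\<close>
  define d where "d = inv_into (carrier F) emb"
  have d: "a \<in> carrier F \<Longrightarrow> d (emb a) = a" for a using inj by (simp add: d_def)
  define L :: "('a, 'v) module" where "L =
    \<lparr>carrier = emb ` carrier F, mult = \<lambda>x y. emb (d x \<otimes>\<^bsub>F\<^esub> d y), one = emb \<one>\<^bsub>F\<^esub>,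
      zero = emb \<zero>\<^bsub>F\<^esub>, add = \<lambda>x y. emb (d x \<oplus>\<^bsub>F\<^esub> d y), smult = \<lambda>a x. emb (a \<otimes>\<^bsub>F\<^esub> d x)\<rparr>"
  have neg: "\<exists>y\<in>carrier F. emb (x \<oplus>\<^bsub>F\<^esub> y) = emb \<zero>\<^bsub>F\<^esub>" if "x \<in> carrier F" for x
    using that by (intro bexI[of _ "\<ominus>\<^bsub>F\<^esub> x"]) (auto simp: r_neg)
  interpret L: vectorspace F L
    by (rule vs_criteria[OF assms(1)])
      (auto simp: L_def d m_assoc l_distr r_distr a_ac neg)
  let ?e = "emb \<one>\<^bsub>F\<^esub>"
  have e: "?e \<in> carrier L" by (simp add: L_def)
  have coordinate: "\<exists>!a. a \<in> carrier F \<and> x = a \<odot>\<^bsub>L\<^esub> ?e" if "x \<in> carrier L" for x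
    using that inj by (auto simp: L_def d inj_on_def)
  \<comment> \<open>The image of one spans \<open>L\<close>, which is therefore finite-dimensional.
    This comes before \<open>line\<close> is available, since that locale presupposes that
    \<open>L\<close> is an object.\<close>
  have "x \<in> L.span {?e}" if x: "x \<in> carrier L" for x
  proof -
    obtain a where a: "a \<in> carrier F" "x = a \<odot>\<^bsub>L\<^esub> ?e" using coordinate[OF x] by blast
    have "submodule F (L.span {?e}) L" using e by (intro L.span_is_submodule) simp
    then show ?thesis
      using a e L.in_own_span[of "{?e}"] by (simp add: submodule.smult_closed)
  qed
  then have "L.gen_set {?e}" using e L.span_is_subset2[of "{?e}"] by auto
  then have "L.fin_dim" unfolding L.fin_dim_def using e by blast
  then have "L \<in> Obj (FinVect F)" using L.vectorspace_axioms by (simp add: Obj_FinVect)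
  with e coordinate show ?thesis by (auto simp: line_def)
qed

lemma (in endofunctor) isomorphic_obj_fob:
  assumes "isomorphic_obj C A B"
  shows "isomorphic_obj C (fob T A) (fob T B)"
proof -
  obtain f g where f: "f \<in> homset C A B" and g: "g \<in> homset C B A"
    and gf: "g \<cdot> f = Idn C A" and fg: "f \<cdot> g = Idn C B"
    using assms by (auto simp: isomorphic_obj_def)
  have "A \<in> Obj C" "B \<in> Obj C" using f dom_obj cod_obj by (auto simp: homset_def)
  then have "far T g \<cdot> far T f = Idn C (fob T A)" "far T f \<cdot> far T g = Idn C (fob T B)"
    using far_cmp[OF f g] far_cmp[OF g f] gf fg far_idn by auto
  then show ?thesis using far_hom[OF f] far_hom[OF g] unfolding isomorphic_obj_def by blast
qed

text \<open>Since \<open>q\<close> equals \<open>p \<cdot> \<pi> 0\<close>, the equation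
  \<open>q \<cdot> h = p \<cdot> u\<close> follows from \<open>\<pi> 0 \<cdot> h = u\<close>. Hence
  both universal properties have the same mediating arrows.\<close>

lemma (in category) fibre_square_is_pullback:
  assumes P: "is_fibre_power C p 2 P q \<pi>"
  shows "is_pullback C (\<pi> 0) (\<pi> 1) p p"
proof -
  have \<pi>: "\<pi> i \<in> homset C P (Dom C p)" "p \<cdot> \<pi> i = q" if "i < 2" for i
    using P that by (auto simp: is_fibre_power_def)
  have p: "p \<in> homset C (Dom C p) (Cod C p)"
    using P by (simp add: is_fibre_power_def homset_def)
  have univ: "\<exists>!h. h \<in> homset C Z (Dom C (\<pi> 0)) \<and> \<pi> 0 \<cdot> h = u \<and> \<pi> 1 \<cdot> h = v"
    if Z: "Z \<in> Obj C" and u: "u \<in> homset C Z (Dom C p)" and v: "v \<in> homset C Z (Dom C p)"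
      and uv: "p \<cdot> u = p \<cdot> v" for Z u v
  proof -
    let ?x = "\<lambda>i::nat. if i = 0 then u else v"
    have pu: "p \<cdot> u \<in> homset C Z (Cod C p)" by (rule cmp_hom[OF u p])
    have "\<exists>!h. h \<in> homset C Z P \<and> q \<cdot> h = p \<cdot> u \<and> (\<forall>i<2. \<pi> i \<cdot> h = ?x i)"
      using u v uv by (intro fibre_power_universal[OF P Z pu]) auto
    moreover have "h \<in> homset C Z P \<and> q \<cdot> h = p \<cdot> u \<and> (\<forall>i<2. \<pi> i \<cdot> h = ?x i) \<longleftrightarrow>
        h \<in> homset C Z (Dom C (\<pi> 0)) \<and> \<pi> 0 \<cdot> h = u \<and> \<pi> 1 \<cdot> h = v" for h
    proof -
      have dom: "homset C Z (Dom C (\<pi> 0)) = homset C Z P" using \<pi>(1)[of 0] by (simp add: homset_def)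
      have "q \<cdot> h = p \<cdot> (\<pi> 0 \<cdot> h)" if "h \<in> homset C Z P"
        using cmp_assoc[OF that \<pi>(1)[of 0] p] \<pi>(2)[of 0] by simp
      then show ?thesis unfolding dom by (auto simp: less_2_cases_iff)
    qed
    ultimately show ?thesis by simp
  qed
  have "\<pi> 0 \<in> Arr C" "\<pi> 1 \<in> Arr C" "p \<in> Arr C"
    "Dom C (\<pi> 0) = Dom C (\<pi> 1)" "Cod C (\<pi> 0) = Dom C p" "Cod C (\<pi> 1) = Dom C p"
    "p \<cdot> \<pi> 0 = p \<cdot> \<pi> 1"
    using p \<pi>[of 0] \<pi>[of 1] by (simp_all add: homset_def)
  with univ show ?thesis unfolding is_pullback_def by blast
qed

section \<open>Dimensions under a Cartesian tangent structure\<close>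

theorem theorem7p11:
  fixes F :: "('a, 'k) ring_scheme"
    and S :: "(('a, 'v) module, ('a, 'v) linear_arrow) tangent_data"
    and emb :: "'a list \<Rightarrow> 'v"
  assumes "field F"
    and universe: "inj_on emb (lists (carrier F))"
    and "cartesian_tangent_category (FinVect F) S"
  shows "(\<forall>V \<in> Obj (FinVect F). isomorphic_obj (FinVect F) (tob S V) V) \<or>
    (\<forall>V \<in> Obj (FinVect F). \<exists>P \<pi>. is_product (FinVect F) 2 (\<lambda>_. V) P \<pi> \<and>
      isomorphic_obj (FinVect F) (tob S V) P)"
proof -
  let ?C = "FinVect F :: (('a, 'v) module, ('a, 'v) linear_arrow) precategory"
  let ?dim = "vectorspace.dim F :: ('a, 'v) module \<Rightarrow> nat"
  interpret cartesian_tangent_category ?C S by fact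
  interpret T: endofunctor ?C "tfun S" by (rule T_functor)
  \<comment> \<open>Singleton lists embed the scalars into \<open>'v\<close>, which provides room
    for a line.\<close>
  have "inj_on (\<lambda>a. emb [a]) (carrier F)"
    by (auto intro!: inj_onI dest: inj_onD[OF universe])
  from line_exists[OF assms(1) this] obtain L :: "('a, 'v) module" and e where "line F L e"
    by blast
  then interpret line F L e .

  define k where "k = ?dim (tob S L)"
  \<comment> \<open>\<open>V\<close> is isomorphic to a power of \<open>L\<close> with exponent
    \<open>?dim V\<close>. The functor carries the isomorphism and the product over, giving a power
    of \<open>tob S L\<close> with the same exponent.\<close>
  have dimT: "?dim (tob S V) = k * ?dim V" if V: "V \<in> Obj ?C" for V
  proof -
    obtain P \<pi> where P: "is_product ?C (?dim V) (\<lambda>_. L) P \<pi>" and iso: "isomorphic_obj ?C V P"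
      using isomorphic_power_L[OF finite_products V] .
    have TP: "is_product ?C (?dim V) (\<lambda>_. tob S L) (tob S P) (\<lambda>i. tar S (\<pi> i))"
      using products_preserved P by (simp add: preserves_finite_products_def)
    have "?dim (tob S V) = ?dim (tob S P)"
      using T.isomorphic_obj_fob[OF iso] P V T.fob_obj
      by (subst isomorphic_obj_iff_dim[symmetric]) (auto simp: is_product_def)
    also have "\<dots> = ?dim V * k" using dim_product[OF TP] by (simp add: k_def)
    finally show ?thesis by simp
  qed

  have TL: "tob S L \<in> Obj ?C" by (rule T.fob_obj[OF L_obj])
  have p: "tproj S L \<in> homset ?C (tob S L) L"
    using p_nat L_obj by (simp add: nat_trans_def fun_id_def)
  have z: "tzero S L \<in> homset ?C L (tob S L)"
    using zero_nat L_obj by (simp add: nat_trans_def fun_id_def)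
  have pz: "tproj S L \<cdot>\<^bsub>?C\<^esub> tzero S L = Idn ?C L"
    and sq: "is_fibre_power ?C (tproj S L) 2 (tsq S L) (tproj S L \<cdot>\<^bsub>?C\<^esub> tpr S L 0) (tpr S L)"
    using tangent_bundle_additive[OF L_obj] by (simp_all add: additive_bundle_def tangent_bundle_def)
  have pr: "tpr S L i \<in> homset ?C (tsq S L) (tob S L)" if "i < 2" for i
    using sq that p by (auto simp: is_fibre_power_def homset_def)
  \<comment> \<open>The fibre square of \<open>p\<close> over \<open>L\<close>, with the zero
    section splitting \<open>p\<close>.\<close>
  have T2: "?dim (tsq S L) + 1 = 2 * k"
    using dim_pullback_FinVect[OF T.fibre_square_is_pullback[OF sq] pr[of 0] pr[of 1] p p z pz]
    by (simp add: dim_L k_def)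

  have Tp: "tar S (tproj S L) \<in> homset ?C (tob S (tob S L)) (tob S L)"
    and Tz: "tar S (tzero S L) \<in> homset ?C (tob S L) (tob S (tob S L))"
    using T.far_hom p z by auto
  \<comment> \<open>Functoriality turns the zero section of \<open>p\<close> into a section of
    \<open>T p\<close>, which makes the right side of the vertical lift square surjective.\<close>
  have TpTz: "tar S (tproj S L) \<cdot>\<^bsub>?C\<^esub> tar S (tzero S L) = Idn ?C (tob S L)"
    using T.far_cmp[OF z p] T.far_idn[OF L_obj] pz by simp
  \<comment> \<open>The zeroth power of \<open>T\<close> is the identity, so this instance is the
    vertical lift square itself.\<close>
  have univ: "is_pullback ?C (vertical_nu ?C S L) (tproj S L \<cdot>\<^bsub>?C\<^esub> tpr S L 0)
      (tar S (tproj S L)) (tzero S L)"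
    using lift_universal[OF L_obj, of 0] by (simp add: fun_id_def)
  have ppr: "tproj S L \<cdot>\<^bsub>?C\<^esub> tpr S L 0 \<in> homset ?C (tsq S L) L"
    using T.cmp_hom[OF pr p] by simp
  have nu: "vertical_nu ?C S L \<in> homset ?C (tsq S L) (tob S (tob S L))"
    using univ ppr Tp by (simp add: is_pullback_def homset_def)
  \<comment> \<open>The same object \<open>tsq S L\<close> is measured a second time;
    \<open>dimT\<close> at \<open>tob S L\<close> gives dimension \<open>k * k\<close> for the
    second tangent space.\<close>
  have "?dim (tsq S L) + k = k * k + 1"
    using dim_pullback_FinVect[OF univ nu ppr Tp z Tz TpTz] dimT[OF TL] by (simp add: dim_L k_def)
  \<comment> \<open>Eliminating \<open>?dim (tsq S L)\<close> leaves a quadratic in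
    \<open>k\<close>; integers permit its factorisation.\<close>
  with T2 have "(int k - 1) * (int k - 2) = 0"
    by (simp add: algebra_simps flip: of_nat_mult of_nat_add)
  then consider "k = 1" | "k = 2" by auto
  then show ?thesis
  proof cases
    case 1
    then show ?thesis using dimT T.fob_obj by (simp add: isomorphic_obj_iff_dim)
  next
    case 2
    \<comment> \<open>Every product of \<open>V\<close> with itself has dimension
      \<open>2 * ?dim V\<close>, which for \<open>k = 2\<close> is the dimension of
      \<open>tob S V\<close>.\<close>
    have "\<exists>P \<pi>. is_product ?C 2 (\<lambda>_. V) P \<pi> \<and> isomorphic_obj ?C (tob S V) P"
      if V: "V \<in> Obj ?C" for V
    proof -
      have "\<exists>P \<pi>. is_product ?C 2 (\<lambda>_. V) P \<pi>"
        using finite_products V by (simp add: has_finite_products_def)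
      then obtain P \<pi> where P: "is_product ?C 2 (\<lambda>_. V) P \<pi>" by blast
      have "?dim (tob S V) = ?dim P" using dim_product[OF P] dimT[OF V] 2 by simp
      then have "isomorphic_obj ?C (tob S V) P"
        using P V T.fob_obj by (simp add: isomorphic_obj_iff_dim is_product_def)
      with P show ?thesis by blast
    qed
    then show ?thesis by blast
  qed
qed

end
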